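(* For every integer $n\ge1$, the fourth factorial moment of the area statistic on parking functions of length $n$ is $$\frac{221}{1008}n^6+\frac{63737}{30240}n^5+\frac{101897}{15120}n^4+\frac{22217}{5040}n^3-\frac{1375}{189}n^2-\frac{187463}{30240}n$$ $$+\left(-\frac{35}{16}n^4-\frac{449}{27}n^3-\frac{130243}{2520}n^2-\frac{7409}{105}n-\frac{503803}{15120}\right)E_1(n),$$ and asymptotically, as $n\to\infty$, it equals $\frac{221}{1008}n^6+O(n^{11/2})$.
   Context: A parking function of length $n$ is a vector of positive integers $(p_1,\dots,p_n)$, $1\le p_i\le n$, whose non-decreasing rearrangement satisfies $p_{(i)}\le i$ for $1\le i\le n$; there are $(n+1)^{n-1}$ of them. The area statistic is $\mathrm{Area}(p)=\frac{n(n+1)}{2}-\sum_{i=1}^n p_i$. Choose $p$ uniformly at random among parking functions of length $n$; the $k$-th factorial moment of the area is $E[A(A-1)\cdots(A-k+1)]$ with $A=\mathrm{Area}(p)$, and $E_1(n)=E[A]$ is its expectation. *)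

theory Defs
  imports "HOL-Probability.Probability" "HOL-Library.Landau_Symbols"
begin

text \<open>
  A vector \<open>(p\<^sub>1, \<dots>, p\<^sub>n)\<close> is a list of length \<open>n\<close>. List positions start at \<open>0\<close>, so the
  condition that the \<open>i\<close>-th smallest entry is at most \<open>i\<close> reads \<open>sort p ! i \<le> i + 1\<close>.
\<close>

definition parking_functions :: "nat \<Rightarrow> nat list set" where
  "parking_functions n =
     {p. length p = n \<and> set p \<subseteq> {1..n} \<and> (\<forall>i<n. sort p ! i \<le> i + 1)}"

definition area :: "nat list \<Rightarrow> int" where
  "area p = int (length p * (length p + 1) div 2) - int (sum_list p)"

definition random_parking_function :: "nat \<Rightarrow> nat list pmf" where
  "random_parking_function n = pmf_of_set (parking_functions n)"

definition expected_area :: "nat \<Rightarrow> real" where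
  "expected_area n = measure_pmf.expectation (random_parking_function n) (\<lambda>p. of_int (area p))"

definition area_factorial_moment :: "nat \<Rightarrow> nat \<Rightarrow> real" where
  "area_factorial_moment k n =
     measure_pmf.expectation (random_parking_function n)
       (\<lambda>p. \<Prod>j<k. of_int (area p) - of_nat j)"

text \<open>
  These two facts are what makes \<^const>\<open>pmf_of_set\<close> the uniform distribution on
  parking functions; on an empty or infinite set it is unspecified.
\<close>

lemma finite_parking_functions: "finite (parking_functions n)"
proof (rule finite_subset)
  show "parking_functions n \<subseteq> {p. set p \<subseteq> {1..n} \<and> length p = n}"
    by (auto simp: parking_functions_def)
qed (rule finite_lists_length_eq, simp)

lemma parking_functions_nonempty: "parking_functions n \<noteq> {}"
proof -
  have "sort (replicate n (1::nat)) = replicate n 1"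
    by (rule sort_key_id_if_sorted) (simp add: sorted_iff_nth_mono)
  then have "replicate n 1 \<in> parking_functions n"
    by (auto simp: parking_functions_def)
  then show ?thesis by blast
qed

end

theory Submission
  imports Defs "HOL-Computational_Algebra.Polynomial_FPS" "HOL-Real_Asymp.Real_Asymp"
begin

text \<open>
  Let \<open>P\<^sub>n(q)\<close> be the sum of \<open>q^Area(p)\<close> over the parking functions \<open>p\<close> of length \<open>n\<close>. If the last
  car is removed from a parking function of length \<open>n + 1\<close>, the other cars leave one empty spot
  \<open>k + 1\<close>: \<open>k\<close> of them form a parking function to its left, \<open>n - k\<close> of them one to its right, and the last
  car prefers any of the spots \<open>1, ..., k + 1\<close>. This gives Kreweras' recursion (\<open>area_enum_Suc\<close>)
  \<open>P\<^sub>n\<^sub>+\<^sub>1(q) = (\<Sum>k\<le>n. C(n, k) (1 + q + ... + q^k) P\<^sub>k(q) P\<^sub>n\<^sub>-\<^sub>k(q))\<close>.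

  The coefficient of \<open>y^j\<close> in \<open>P\<^sub>n(1 + y)\<close> is the sum of \<open>C(Area(p), j)\<close>, that is, the \<open>j\<close>-th factorial
  moment up to the factors \<open>j!\<close> and \<open>P\<^sub>n(1)\<close>. For the exponential generating functions \<open>F\<^sub>j(z)\<close> of these
  coefficients the recursion becomes a triangular system of differential equations with a unique
  solution (\<open>area_ode_area_egf\<close>, \<open>area_ode_unique\<close>). Here \<open>z F\<^sub>0\<close> is the tree function \<open>T\<close>, and in terms of
  \<open>v = T/(1 - T)\<close> one has \<open>z F\<^sub>0' = v F\<^sub>0\<close> and \<open>z v' = v (1 + v)^2\<close>. So \<open>z d/dz\<close> preserves the set of
  products of \<open>F\<^sub>0\<close> with a polynomial in \<open>v\<close>, and for \<open>j \<le> 4\<close> the system is solved within this set by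
  explicit polynomials (\<open>area_egf_eq_tree_subst\<close>). Since \<open>z d/dz\<close> multiplies the coefficient of
  \<open>z^n\<close> by \<open>n\<close>, an identity \<open>24 F\<^sub>4 = a(z d/dz) F\<^sub>0 + b(z d/dz) F\<^sub>1\<close> with polynomials \<open>a\<close> and \<open>b\<close> is the
  same as the formula \<open>a(n) + b(n) E\<^sub>1(n)\<close> for the fourth factorial moment. It is an identity of
  polynomials in \<open>v\<close> (\<open>moment_poly_4\<close>).

  For the asymptotics it suffices that \<open>E\<^sub>1(n)\<close> is \<open>O(n^(3/2))\<close>. The same method expresses the second
  factorial moment as a cubic polynomial in \<open>n\<close> minus a nonnegative multiple of \<open>E\<^sub>1(n)\<close>, and
  \<open>E\<^sub>1(n)^2\<close> is at most the second moment (\<open>expected_area_power2_le\<close>).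
\<close>

unbundle no vec_syntax
unbundle fps_syntax

section \<open>Splitting a parking function at its first gap\<close>

text \<open>
  Maps on an arbitrary finite index set take the place of lists, because a parking function will
  be cut into its restrictions to two complementary sets of positions. The order condition on the
  sorted entries becomes a counting condition, which does not refer to sorting.
\<close>

definition parking_maps :: "'i set \<Rightarrow> ('i \<Rightarrow> nat) set" where
  "parking_maps I = {f \<in> I \<rightarrow>\<^sub>E {1..}. \<forall>j\<le>card I. j \<le> card {i\<in>I. f i \<le> j}}"

definition map_area :: "'i set \<Rightarrow> ('i \<Rightarrow> nat) \<Rightarrow> nat" where
  "map_area I f = (card I * (card I + 1)) div 2 - sum f I"

lemma parking_map_le:
  assumes "finite I" "f \<in> parking_maps I" "i \<in> I"
  shows "f i \<le> card I"
proof -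
  have "{i\<in>I. f i \<le> card I} = I"
    using assms by (intro card_seteq) (auto simp: parking_maps_def)
  then show ?thesis
    using assms(3) by blast
qed

lemma parking_map_ge_1: "f \<in> parking_maps I \<Longrightarrow> i \<in> I \<Longrightarrow> 1 \<le> f i"
  by (simp add: parking_maps_def PiE_iff)

lemma parking_map_undefined: "f \<in> parking_maps I \<Longrightarrow> i \<notin> I \<Longrightarrow> f i = undefined"
  by (auto simp: parking_maps_def PiE_iff extensional_def)

lemma finite_parking_maps:
  assumes "finite I"
  shows "finite (parking_maps I)"
proof (rule finite_subset)
  show "parking_maps I \<subseteq> I \<rightarrow>\<^sub>E {..card I}"
  proof
    fix f assume f: "f \<in> parking_maps I"
    then have "f \<in> extensional I"
      by (simp add: parking_maps_def PiE_iff)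
    then show "f \<in> I \<rightarrow>\<^sub>E {..card I}"
      using parking_map_le[OF assms f] by (simp add: PiE_iff)
  qed
qed (use assms in \<open>simp add: finite_PiE\<close>)

text \<open>
  Counting pairs \<open>j < f i\<close> by \<open>j\<close> turns the sum of \<open>f\<close> into the sum over \<open>j\<close> of the number of entries
  above \<open>j\<close>, which is at most \<open>card I - j\<close>. So the truncated subtraction in \<^const>\<open>map_area\<close> loses nothing.
\<close>

lemma sum_parking_map_le:
  assumes I: "finite I" and f: "f \<in> parking_maps I"
  shows "sum f I \<le> (card I * (card I + 1)) div 2"
proof -
  define n where "n = card I"
  have "sum f I = (\<Sum>i\<in>I. \<Sum>j<n. if j < f i then 1 else 0)"
  proof (rule sum.cong)
    fix i assume "i \<in> I"
    then have "f i \<le> n"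
      using parking_map_le[OF I f] by (simp add: n_def)
    then have "{j\<in>{..<n}. j < f i} = {..<f i}"
      by auto
    then show "f i = (\<Sum>j<n. if j < f i then 1 else 0)"
      by (simp add: sum.If_cases Int_def)
  qed simp
  also have "\<dots> = (\<Sum>j<n. card {i\<in>I. j < f i})"
    using I by (subst sum.swap) (simp add: sum.If_cases Int_def)
  also have "\<dots> \<le> (\<Sum>j<n. n - j)"
  proof (rule sum_mono)
    fix j assume j: "j \<in> {..<n}"
    have "{i\<in>I. j < f i} = I - {i\<in>I. f i \<le> j}"
      by auto
    then have "card {i\<in>I. j < f i} = n - card {i\<in>I. f i \<le> j}"
      using I by (simp add: card_Diff_subset n_def)
    also have "\<dots> \<le> n - j"
      using f j by (intro diff_le_mono2) (auto simp: parking_maps_def n_def)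
    finally show "card {i\<in>I. j < f i} \<le> n - j" .
  qed
  also have "(\<Sum>j<n. n - j) = (\<Sum>j<n. Suc j)"
    by (rule sum.reindex_bij_witness[where i = "\<lambda>j. n - Suc j" and j = "\<lambda>j. n - Suc j"]) auto
  also have "\<dots> = n * (n + 1) div 2"
    by (induction n) auto
  finally show ?thesis
    by (simp add: n_def)
qed

text \<open>
  If cars with preferences \<open>f\<close> park one after the other, this is the first spot that stays empty.
\<close>

definition first_gap :: "'i set \<Rightarrow> ('i \<Rightarrow> nat) \<Rightarrow> nat" where
  "first_gap I f = (LEAST j. card {i\<in>I. f i \<le> j} < j)"

definition before_gap :: "'i set \<Rightarrow> ('i \<Rightarrow> nat) \<Rightarrow> 'i set" where
  "before_gap I f = {i\<in>I. f i < first_gap I f}"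

text \<open>
  The inverse of the splitting: the last car \<open>a\<close> is added to a parking function \<open>g\<close> on the spots up
  to \<open>card S\<close> and a parking function \<open>h\<close> on the spots from \<open>card S + 2\<close> on. The number \<open>x\<close> is the
  distance that \<open>a\<close> travels to the gap \<open>card S + 1\<close>, and this distance is what \<open>a\<close> adds to the area.
\<close>

definition glue :: "'i \<Rightarrow> 'i set \<Rightarrow> 'i set \<Rightarrow> ('i \<Rightarrow> nat) \<Rightarrow> ('i \<Rightarrow> nat) \<Rightarrow> nat \<Rightarrow> 'i \<Rightarrow> nat" where
  "glue a I S g h x = (\<lambda>i. if i = a then Suc (card S) - x else if i \<in> S then g i
     else if i \<in> I then Suc (card S) + h i else undefined)"

lemma glue_count:
  assumes "finite I" "a \<notin> I" "S \<subseteq> I" "g \<in> parking_maps S" "h \<in> parking_maps (I - S)"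
  shows "card {i\<in>I. glue a I S g h x i \<le> j} =
    card {i\<in>S. g i \<le> j} + (if Suc (card S) \<le> j then card {i\<in>I-S. h i \<le> j - Suc (card S)} else 0)"
proof -
  have fS: "finite S"
    using assms finite_subset by blast
  have "{i\<in>I. glue a I S g h x i \<le> j} = {i\<in>S. g i \<le> j} \<union> {i\<in>I-S. Suc (card S) + h i \<le> j}"
    using assms by (auto simp: glue_def)
  also have "card \<dots> = card {i\<in>S. g i \<le> j} + card {i\<in>I-S. Suc (card S) + h i \<le> j}"
    using fS assms by (intro card_Un_disjoint) auto
  also have "{i\<in>I-S. Suc (card S) + h i \<le> j} =
      (if Suc (card S) \<le> j then {i\<in>I-S. h i \<le> j - Suc (card S)} else {})"
    by auto
  finally show ?thesis
    by simp
qed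

lemma count_parking_map:
  assumes "finite I" "f \<in> parking_maps I"
  shows "j \<le> card I \<Longrightarrow> j \<le> card {i\<in>I. f i \<le> j}" "card I \<le> j \<Longrightarrow> card {i\<in>I. f i \<le> j} = card I"
proof -
  assume "card I \<le> j"
  then have "{i\<in>I. f i \<le> j} = I"
    using parking_map_le[OF assms] by fastforce
  then show "card {i\<in>I. f i \<le> j} = card I"
    by simp
qed (use assms in \<open>simp add: parking_maps_def\<close>)

lemma glue_first_gap:
  assumes "finite I" "a \<notin> I" "S \<subseteq> I" "g \<in> parking_maps S" "h \<in> parking_maps (I - S)"
  shows "first_gap I (glue a I S g h x) = Suc (card S)"
  unfolding first_gap_def
proof (rule Least_equality)
  have fS: "finite S"
    using assms finite_subset by blast
  have "{i \<in> I - S. h i \<le> 0} = {}"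
    using parking_map_ge_1[OF assms(5)] by fastforce
  then have "card {i \<in> I - S. h i \<le> 0} = 0"
    by (metis card.empty)
  then show "card {i \<in> I. glue a I S g h x i \<le> Suc (card S)} < Suc (card S)"
    unfolding glue_count[OF assms] by (simp add: count_parking_map(2)[OF fS assms(4)])
  fix y assume y: "card {i \<in> I. glue a I S g h x i \<le> y} < y"
  show "Suc (card S) \<le> y"
  proof (rule ccontr)
    assume "\<not> Suc (card S) \<le> y"
    then show False
      using y count_parking_map(1)[OF fS assms(4), of y] unfolding glue_count[OF assms] by simp
  qed
qed

lemma glue_before_gap:
  assumes "finite I" "a \<notin> I" "S \<subseteq> I" "g \<in> parking_maps S" "h \<in> parking_maps (I - S)"
  shows "before_gap I (glue a I S g h x) = S"
proof -
  have "finite S"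
    using assms finite_subset by blast
  then have le: "g i \<le> card S" if "i \<in> S" for i
    using parking_map_le[OF _ assms(4) that] by simp
  have "glue a I S g h x i < Suc (card S) \<longleftrightarrow> i \<in> S" if i: "i \<in> I" for i
  proof -
    have "i \<noteq> a"
      using i assms(2) by blast
    then show ?thesis
      using i le[of i] by (simp add: glue_def less_Suc_eq_le)
  qed
  then show ?thesis
    unfolding before_gap_def glue_first_gap[OF assms] using assms(3)
    by (simp add: set_eq_iff subset_iff cong: conj_cong) metis
qed

lemma card_le_insert:
  assumes "finite I" "a \<notin> I"
  shows "card {i\<in>insert a I. f i \<le> (j::nat)} = card {i\<in>I. f i \<le> j} + (if f a \<le> j then 1 else 0)"
proof -
  have "{i\<in>insert a I. f i \<le> j} = (if f a \<le> j then insert a {i\<in>I. f i \<le> j} else {i\<in>I. f i \<le> j})"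
    by auto
  then show ?thesis
    using assms by simp
qed

lemma glue_parking:
  assumes "finite I" "a \<notin> I" "S \<subseteq> I" "g \<in> parking_maps S" "h \<in> parking_maps (I - S)"
    and x: "x \<le> card S"
  shows "glue a I S g h x \<in> parking_maps (insert a I)"
proof -
  have fS: "finite S" "finite (I - S)"
    using assms finite_subset by blast+
  have cI: "card I = card S + card (I - S)"
    using assms fS by (metis card_Diff_subset card_mono le_add_diff_inverse)
  have "j \<le> card {i\<in>insert a I. glue a I S g h x i \<le> j}" if j: "j \<le> Suc (card I)" for j
  proof (cases "j \<le> card S")
    case True
    then show ?thesis
      using count_parking_map(1)[OF fS(1) assms(4), of j]
      unfolding card_le_insert[OF assms(1,2)] glue_count[OF assms(1-5)] by simp
  next
    case False
    then have "j - Suc (card S) \<le> card {i\<in>I-S. h i \<le> j - Suc (card S)}"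
      using j cI by (intro count_parking_map(1)[OF fS(2) assms(5)]) simp
    moreover have "glue a I S g h x a \<le> j"
      using False by (simp add: glue_def)
    ultimately show ?thesis
      using False unfolding card_le_insert[OF assms(1,2)] glue_count[OF assms(1-5)]
      by (simp add: count_parking_map(2)[OF fS(1) assms(4)])
  qed
  moreover have "glue a I S g h x \<in> insert a I \<rightarrow>\<^sub>E {1..}"
    using assms by (auto simp: glue_def parking_maps_def PiE_iff extensional_def)
  ultimately show ?thesis
    unfolding parking_maps_def card_insert_disjoint[OF assms(1,2)] by blast
qed

lemma glue_area:
  assumes "finite I" "a \<notin> I" "S \<subseteq> I" "g \<in> parking_maps S" "h \<in> parking_maps (I - S)"
    and x: "x \<le> card S"
  shows "map_area (insert a I) (glue a I S g h x) = x + map_area S g + map_area (I - S) h"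
proof -
  define k m where "k = card S" and "m = card (I - S)"
  have fS: "finite S" "finite (I - S)"
    using assms finite_subset by blast+
  have cI: "card I = k + m"
    using assms fS unfolding k_def m_def by (metis card_Diff_subset card_mono le_add_diff_inverse)
  have "sum (glue a I S g h x) (insert a I) = (Suc k - x) + sum (glue a I S g h x) (S \<union> (I - S))"
    using assms by (simp add: glue_def k_def Un_absorb1)
  also have "sum (glue a I S g h x) (S \<union> (I - S)) =
      sum (glue a I S g h x) S + sum (glue a I S g h x) (I - S)"
    using fS by (intro sum.union_disjoint) auto
  also have "sum (glue a I S g h x) S = sum g S"
    using assms by (intro sum.cong) (auto simp: glue_def)
  also have "sum (glue a I S g h x) (I - S) = (\<Sum>i\<in>I-S. Suc k + h i)"
    using assms by (intro sum.cong) (auto simp: glue_def k_def)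
  also have "\<dots> = m * Suc k + sum h (I - S)"
    by (simp only: sum.distrib sum_constant m_def of_nat_id)
  finally have s: "sum (glue a I S g h x) (insert a I) = (Suc k - x) + (sum g S + (m * Suc k + sum h (I - S)))" .
  have tri: "(k + m + 1) * (k + m + 2) div 2 = k * (k + 1) div 2 + m * (m + 1) div 2 + m * Suc k + Suc k"
  proof -
    have "(k + m + 1) * (k + m + 2) = k * (k + 1) + m * (m + 1) + 2 * (m * Suc k + Suc k)"
      by (simp add: algebra_simps)
    moreover obtain c d where "k * (k + 1) = 2 * c" "m * (m + 1) = 2 * d"
      by (metis dvdE even_mult_iff even_plus_one_iff)
    ultimately show ?thesis
      by simp
  qed
  have "sum g S \<le> k * (k + 1) div 2" "sum h (I - S) \<le> m * (m + 1) div 2"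
    using sum_parking_map_le[OF fS(1) assms(4)] sum_parking_map_le[OF fS(2) assms(5)]
    by (simp_all add: k_def m_def)
  moreover have "A + B + C + Suc k - (Suc k - x + (u + (C + v))) = x + (A - u) + (B - v)"
    if "u \<le> A" "v \<le> B" for A B C u v
    using that x k_def by linarith
  moreover have "card (insert a I) = k + m + 1"
    using assms cI by simp
  ultimately show ?thesis
    unfolding map_area_def k_def[symmetric] m_def[symmetric] s
    using tri by (simp only: add.assoc one_add_one)
qed

text \<open>
  Without \<open>a\<close>, the counting condition fails at the gap \<open>e\<close> by exactly one, since \<open>a\<close> can repair a
  deficit of at most one. Hence \<open>a\<close> prefers a spot up to \<open>e\<close>, exactly \<open>e - 1\<close> of the other entries lie
  below \<open>e\<close>, and none of them equals \<open>e\<close>. The counting condition then splits at \<open>e\<close>.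
\<close>

lemma parking_map_gap:
  assumes I: "finite I" "a \<notin> I" and f: "f \<in> parking_maps (insert a I)"
  defines "S \<equiv> before_gap I f"
  shows "first_gap I f = Suc (card S)" "1 \<le> f a" "f a \<le> Suc (card S)"
    "\<And>i. i \<in> I - S \<Longrightarrow> Suc (card S) < f i"
    "restrict f S \<in> parking_maps S"
    "(\<lambda>i\<in>I-S. f i - Suc (card S)) \<in> parking_maps (I - S)"
proof -
  define N where "N j = card {i\<in>I. f i \<le> j}" for j
  define e where "e = first_gap I f"
  have SI: "S \<subseteq> I"
    by (auto simp: S_def before_gap_def)
  then have fS: "finite S"
    using I finite_subset by blast
  have park: "j \<le> N j + (if f a \<le> j then 1 else 0)" if "j \<le> Suc (card I)" for j
  proof -
    have "j \<le> card {i\<in>insert a I. f i \<le> j}"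
      using f that I by (simp add: parking_maps_def)
    then show ?thesis
      unfolding card_le_insert[OF I] N_def .
  qed
  have "N (Suc (card I)) < Suc (card I)"
    unfolding N_def using I by (auto intro!: card_mono simp: less_Suc_eq_le)
  then have e: "N e < e" "e \<le> Suc (card I)"
    unfolding e_def first_gap_def N_def[symmetric] by (auto intro: LeastI Least_le)
  have below: "j \<le> N j" if "j < e" for j
    using not_less_Least[of j "\<lambda>j. N j < j"] that
    unfolding e_def first_gap_def N_def[symmetric] by simp
  \<comment> \<open>At \<open>j = e\<close> the count without \<open>a\<close> is below \<open>e\<close> and the count with \<open>a\<close> is not.\<close>
  have Ne: "e = Suc (N e)" and fa: "f a \<le> e"
    using park[OF e(2)] e(1) by (auto split: if_splits)
  have "{i\<in>I. f i \<le> N e} = {i\<in>I. f i \<le> e}"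
  proof (rule card_seteq)
    show "card {i\<in>I. f i \<le> e} \<le> card {i\<in>I. f i \<le> N e}"
      using below[of "N e"] e(1) unfolding N_def[symmetric] by simp
  qed (use I Ne in auto)
  moreover have "S = {i\<in>I. f i \<le> N e}"
    using Ne by (auto simp: S_def before_gap_def e_def[symmetric])
  ultimately have S: "S = {i\<in>I. f i \<le> N e}" "S = {i\<in>I. f i \<le> e}"
    by auto
  then have cS: "card S = N e"
    by (simp add: N_def)
  show gap: "first_gap I f = Suc (card S)"
    using Ne cS e_def by simp
  show "1 \<le> f a"
    using f by (auto simp: parking_maps_def PiE_iff)
  show "f a \<le> Suc (card S)"
    using fa cS Ne by simp
  show above: "Suc (card S) < f i" if "i \<in> I - S" for i
    using that S(2) cS Ne by auto
  have "j \<le> card {i\<in>S. restrict f S i \<le> j}" if j: "j \<le> card S" for j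
  proof -
    have "{i\<in>S. restrict f S i \<le> j} = {i\<in>I. f i \<le> j}"
      using j S(1) cS by auto
    then show ?thesis
      using below[of j] j cS Ne by (simp add: N_def)
  qed
  moreover have "restrict f S \<in> S \<rightarrow>\<^sub>E {1..}"
    using parking_map_ge_1[OF f] SI by (auto simp: PiE_iff)
  ultimately show "restrict f S \<in> parking_maps S"
    unfolding parking_maps_def by blast
  have "j \<le> card {i\<in>I-S. (\<lambda>i\<in>I-S. f i - Suc (card S)) i \<le> j}" if j: "j \<le> card (I - S)" for j
  proof -
    have "{i\<in>I-S. (\<lambda>i\<in>I-S. f i - Suc (card S)) i \<le> j} = {i\<in>I. f i \<le> j + e} - S"
      using cS Ne by auto
    moreover have "S \<subseteq> {i\<in>I. f i \<le> j + e}"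
      using S(2) by auto
    ultimately have "card {i\<in>I-S. (\<lambda>i\<in>I-S. f i - Suc (card S)) i \<le> j} = N (j + e) - N e"
      using fS by (simp add: card_Diff_subset N_def cS)
    moreover have "j + e \<le> Suc (card I)"
      using j card_Diff_subset[OF fS SI] card_mono[OF I(1) SI] cS Ne by linarith
    ultimately show ?thesis
      using park[of "j + e"] Ne by (simp split: if_splits)
  qed
  moreover have "(\<lambda>i\<in>I-S. f i - Suc (card S)) \<in> (I - S) \<rightarrow>\<^sub>E {1..}"
    using above by (auto simp: PiE_iff Suc_le_eq)
  ultimately show "(\<lambda>i\<in>I-S. f i - Suc (card S)) \<in> parking_maps (I - S)"
    unfolding parking_maps_def by blast
qed

definition area_enum :: "'a::comm_semiring_1 \<Rightarrow> 'i set \<Rightarrow> 'a" where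
  "area_enum q I = (\<Sum>f\<in>parking_maps I. q ^ map_area I f)"

text \<open>
  \<^const>\<open>glue\<close> is a bijection, and the area is additive along it. The geometric sum comes from the
  distance that the last car travels.
\<close>

lemma area_enum_insert:
  assumes I: "finite I" "a \<notin> I"
  shows "area_enum q (insert a I) =
    (\<Sum>S\<in>Pow I. (\<Sum>x<Suc (card S). q ^ x) * area_enum q S * area_enum q (I - S))"
proof -
  define B where "B S = {..<Suc (card S)} \<times> parking_maps S \<times> parking_maps (I - S)" for S
  define T where "T = (SIGMA S:Pow I. B S)"
  \<comment> \<open>the splitting at the first gap, inverse to \<open>paste\<close>\<close>
  define cut where "cut f = (let S = before_gap I f in
    (S, Suc (card S) - f a, restrict f S, \<lambda>i\<in>I-S. f i - Suc (card S)))" for f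
  define paste where "paste = (\<lambda>(S, x, g, h). glue a I S g h x)"
  have fin: "finite S" "finite (I - S)" if "S \<subseteq> I" for S
    using that I finite_subset by blast+
  have "area_enum q (insert a I) =
      (\<Sum>(S, x, g, h)\<in>T. q ^ (x + map_area S g + map_area (I - S) h))"
    unfolding area_enum_def
  proof (rule sum.reindex_bij_witness[where i = paste and j = cut])
    fix f assume f: "f \<in> parking_maps (insert a I)"
    note gap = parking_map_gap[OF I f]
    have sub: "before_gap I f \<subseteq> I"
      by (auto simp: before_gap_def)
    have ext: "f i = undefined" if "i \<notin> insert a I" for i
      using parking_map_undefined[OF f that] .
    show paste: "paste (cut f) = f"
    proof
      fix i
      show "paste (cut f) i = f i"
        using gap(3) gap(4)[of i] ext[of i] sub
        by (auto simp: paste_def cut_def Let_def glue_def less_imp_le)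
    qed
    show cut: "cut f \<in> T"
      unfolding T_def B_def cut_def Let_def using sub gap(2,5,6)
      by (intro SigmaI PowI) (auto simp: less_Suc_eq_le)
    have "map_area (insert a I) f = map_area (insert a I) (paste (cut f))"
      by (simp add: paste)
    also have "\<dots> = (\<lambda>(S, x, g, h). x + map_area S g + map_area (I - S) h) (cut f)"
      using cut unfolding paste_def by (auto simp: T_def B_def intro!: glue_area[OF I])
    finally show "(case cut f of (S, x, g, h) \<Rightarrow> q ^ (x + map_area S g + map_area (I - S) h)) =
        q ^ map_area (insert a I) f"
      by (simp add: case_prod_unfold)
  next
    fix t assume "t \<in> T"
    then obtain S x g h where t: "t = (S, x, g, h)" and S: "S \<subseteq> I" and x: "x \<le> card S"
      and g: "g \<in> parking_maps S" and h: "h \<in> parking_maps (I - S)"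
      by (auto simp: T_def B_def)
    show "paste t \<in> parking_maps (insert a I)"
      using glue_parking[OF I S g h x] by (simp add: paste_def t)
    have "restrict (glue a I S g h x) S = g"
      using parking_map_undefined[OF g] S I by (auto simp: glue_def fun_eq_iff)
    moreover have "(\<lambda>i\<in>I-S. glue a I S g h x i - Suc (card S)) = h"
      using parking_map_undefined[OF h] S I by (auto simp: glue_def fun_eq_iff)
    moreover have "Suc (card S) - glue a I S g h x a = x"
      using x by (simp add: glue_def)
    ultimately show "cut (paste t) = t"
      by (simp add: cut_def paste_def t glue_before_gap[OF I S g h])
  qed
  also have "\<dots> = (\<Sum>S\<in>Pow I. \<Sum>(x, g, h)\<in>B S. q ^ (x + map_area S g + map_area (I - S) h))"
    unfolding T_def using I fin by (subst sum.Sigma) (auto simp: B_def finite_parking_maps)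
  also have "\<dots> = (\<Sum>S\<in>Pow I. (\<Sum>x<Suc (card S). q ^ x) * area_enum q S * area_enum q (I - S))"
  proof (rule sum.cong)
    fix S assume "S \<in> Pow I"
    show "(\<Sum>(x, g, h)\<in>B S. q ^ (x + map_area S g + map_area (I - S) h)) =
        (\<Sum>x<Suc (card S). q ^ x) * area_enum q S * area_enum q (I - S)"
    proof -
      have "(\<Sum>(x, g, h)\<in>B S. q ^ (x + map_area S g + map_area (I - S) h)) =
          (\<Sum>x<Suc (card S). \<Sum>g\<in>parking_maps S. \<Sum>h\<in>parking_maps (I - S).
             q ^ x * q ^ map_area S g * q ^ map_area (I - S) h)"
        unfolding B_def sum.cartesian_product by (simp only: power_add case_prod_unfold fst_conv snd_conv)
      then show ?thesis
        by (simp only: area_enum_def sum_distrib_left[symmetric] sum_distrib_right[symmetric])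
    qed
  qed simp
  finally show ?thesis .
qed

lemma area_enum_bij:
  assumes "bij_betw b I J" "finite I"
  shows "area_enum q I = area_enum q J"
proof -
  define c where "c = inv_into I b"
  have b: "b ` I = J" "inj_on b I"
    using assms by (auto simp: bij_betw_def)
  then have fJ: "finite J"
    using assms(2) by blast
  have c: "\<And>i. i \<in> I \<Longrightarrow> c (b i) = i" "\<And>j. j \<in> J \<Longrightarrow> b (c j) = j" "\<And>j. j \<in> J \<Longrightarrow> c j \<in> I"
    using b by (auto simp: c_def inv_into_into f_inv_into_f)
  have card: "card J = card I"
    using bij_betw_same_card[OF assms(1)] by simp
  have count: "card {i\<in>I. f i \<le> j} = card {i\<in>J. g i \<le> j}"
    if "\<And>i. i \<in> I \<Longrightarrow> f i = g (b i)" for f g and j :: nat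
  proof -
    have "inj_on b {i\<in>I. f i \<le> j}"
      using b(2) by (rule inj_on_subset) auto
    then have "card {i\<in>I. f i \<le> j} = card (b ` {i\<in>I. f i \<le> j})"
      by (rule card_image[symmetric])
    also have "b ` {i\<in>I. f i \<le> j} = {i\<in>J. g i \<le> j}"
      using that b(1) by auto
    finally show ?thesis .
  qed
  show ?thesis
    unfolding area_enum_def
  proof (rule sum.reindex_bij_witness[where i = "\<lambda>g. restrict (g \<circ> b) I" and j = "\<lambda>f. restrict (f \<circ> c) J"])
    fix f assume f: "f \<in> parking_maps I"
    have fb: "f i = restrict (f \<circ> c) J (b i)" if "i \<in> I" for i
      using that b c by auto
    have cnt: "card {i\<in>J. restrict (f \<circ> c) J i \<le> j} = card {i\<in>I. f i \<le> j}" for j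
      by (rule count[symmetric]) (rule fb)
    show "restrict (restrict (f \<circ> c) J \<circ> b) I = f"
      using parking_map_undefined[OF f] b c by (auto simp: fun_eq_iff)
    have "restrict (f \<circ> c) J \<in> J \<rightarrow>\<^sub>E {1..}"
      using parking_map_ge_1[OF f c(3)] by (simp add: PiE_iff)
    then show "restrict (f \<circ> c) J \<in> parking_maps J"
      using count_parking_map(1)[OF assms(2) f] unfolding parking_maps_def mem_Collect_eq cnt card by blast
    have "sum f I = sum (restrict (f \<circ> c) J) J"
      using sum.reindex[OF b(2), of "restrict (f \<circ> c) J"] b(1) fb by simp
    then show "q ^ map_area J (restrict (f \<circ> c) J) = q ^ map_area I f"
      by (simp add: map_area_def card)
  next
    fix g assume g: "g \<in> parking_maps J"
    show "restrict (restrict (g \<circ> b) I \<circ> c) J = g"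
      using parking_map_undefined[OF g] b c by (auto simp: fun_eq_iff)
    have cnt: "card {i\<in>I. restrict (g \<circ> b) I i \<le> j} = card {i\<in>J. g i \<le> j}" for j
      by (rule count) simp
    have "restrict (g \<circ> b) I \<in> I \<rightarrow>\<^sub>E {1..}"
      using parking_map_ge_1[OF g] b(1) by (auto simp: PiE_iff)
    then show "restrict (g \<circ> b) I \<in> parking_maps I"
      using count_parking_map(1)[OF fJ g] unfolding parking_maps_def mem_Collect_eq cnt card by blast
  qed
qed

lemma sum_Pow_card:
  assumes "finite I"
  shows "(\<Sum>S\<in>Pow I. h (card S)) = (\<Sum>k\<le>card I. of_nat (card I choose k) * (h k :: 'a::comm_semiring_1))"
proof -
  have "(\<Sum>S\<in>Pow I. h (card S)) = (\<Sum>k\<le>card I. \<Sum>S\<in>{S\<in>Pow I. card S = k}. h (card S))"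
    using assms by (intro sum.group[symmetric]) (auto intro: card_mono)
  also have "\<dots> = (\<Sum>k\<le>card I. of_nat (card I choose k) * h k)"
    using n_subsets[OF assms] by (intro sum.cong) (simp_all add: Pow_def)
  finally show ?thesis .
qed

lemma area_enum_lessThan: "finite S \<Longrightarrow> area_enum q S = area_enum q {..<card S}"
proof -
  assume "finite S"
  then obtain b where "bij_betw b S {..<card S}"
    using ex_bij_betw_finite_nat[of S] by (auto simp: atLeast0LessThan)
  then show ?thesis
    using \<open>finite S\<close> by (rule area_enum_bij)
qed

text \<open>
  This is Kreweras' recursion for the area enumerator of parking functions.
\<close>

lemma area_enum_Suc:
  "area_enum q {..<Suc n} = (\<Sum>k\<le>n. of_nat (n choose k) *
     ((\<Sum>x<Suc k. q ^ x) * area_enum q {..<k} * area_enum q {..<n-k}))"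
proof -
  have "area_enum q {..<Suc n} = (\<Sum>S\<in>Pow {..<n}. (\<Sum>x<Suc (card S). q ^ x) * area_enum q S * area_enum q ({..<n} - S))"
    by (simp add: lessThan_Suc area_enum_insert)
  also have "\<dots> = (\<Sum>S\<in>Pow {..<n}. (\<Sum>x<Suc (card S). q ^ x) * area_enum q {..<card S} * area_enum q {..<n - card S})"
  proof (rule sum.cong)
    fix S assume S: "S \<in> Pow {..<n}"
    then have "finite S" "card ({..<n} - S) = n - card S"
      using finite_subset[of S "{..<n}"] by (auto simp: card_Diff_subset)
    then show "(\<Sum>x<Suc (card S). q ^ x) * area_enum q S * area_enum q ({..<n} - S) =
        (\<Sum>x<Suc (card S). q ^ x) * area_enum q {..<card S} * area_enum q {..<n - card S}"
      using area_enum_lessThan[of S q] area_enum_lessThan[of "{..<n} - S" q] by simp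
  qed simp
  also have "\<dots> = (\<Sum>k\<le>n. of_nat (n choose k) *
     ((\<Sum>x<Suc k. q ^ x) * area_enum q {..<k} * area_enum q {..<n-k}))"
    using sum_Pow_card[of "{..<n}" "\<lambda>k. (\<Sum>x<Suc k. q ^ x) * area_enum q {..<k} * area_enum q {..<n-k}"]
    by (simp only: finite_lessThan card_lessThan simp_thms)
  finally show ?thesis .
qed

lemma area_enum_empty: "area_enum q ({} :: 'i set) = 1"
proof -
  have "parking_maps ({} :: 'i set) = {\<lambda>_. undefined}"
    by (simp add: parking_maps_def)
  then show ?thesis
    by (simp add: area_enum_def map_area_def)
qed

section \<open>Parking functions as lists\<close>

text \<open>
  In the sorted list the entries that are at most \<open>c\<close> form an initial segment.
\<close>

lemma sort_nth_le_iff: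
  fixes p :: "nat list"
  assumes "i < length p"
  shows "sort p ! i \<le> c \<longleftrightarrow> i < card {j. j < length p \<and> p ! j \<le> c}"
proof -
  define s where "s = sort p"
  have "card {j. j < length p \<and> p ! j \<le> c} = length (filter (\<lambda>x. x \<le> c) p)"
    by (simp add: length_filter_conv_card)
  also have "\<dots> = length (filter (\<lambda>x. x \<le> c) s)"
    by (metis s_def mset_filter mset_sort size_mset)
  also have "\<dots> = card {j. j < length s \<and> s ! j \<le> c}"
    by (simp add: length_filter_conv_card)
  finally have eq: "card {j. j < length p \<and> p ! j \<le> c} = card {j. j < length s \<and> s ! j \<le> c}" .
  have mono: "s ! j \<le> s ! k" if "j \<le> k" "k < length s" for j k
    using that by (simp add: s_def sorted_nth_mono)
  have i: "i < length s"
    using assms by (simp add: s_def)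
  show ?thesis
  proof
    assume "sort p ! i \<le> c"
    then have "s ! j \<le> c" if "j \<le> i" for j
      using mono[OF that i] by (simp add: s_def)
    then have "{..i} \<subseteq> {j. j < length s \<and> s ! j \<le> c}"
      using i by auto
    then have "card {..i} \<le> card {j. j < length s \<and> s ! j \<le> c}"
      by (intro card_mono) auto
    then show "i < card {j. j < length p \<and> p ! j \<le> c}"
      unfolding eq by simp
  next
    assume less: "i < card {j. j < length p \<and> p ! j \<le> c}"
    show "sort p ! i \<le> c"
    proof (rule ccontr)
      assume "\<not> sort p ! i \<le> c"
      then have "j < i" if "j < length s" "s ! j \<le> c" for j
        using mono[OF _ that(1), of i] that(2) unfolding s_def[symmetric] by linarith
      then have "card {j. j < length s \<and> s ! j \<le> c} \<le> card {..<i}"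
        by (intro card_mono) auto
      then show False
        using less unfolding eq by simp
    qed
  qed
qed

lemma parking_functions_iff:
  assumes "length p = n"
  shows "p \<in> parking_functions n \<longleftrightarrow> (\<lambda>i\<in>{..<n}. p ! i) \<in> parking_maps {..<n}"
proof -
  define f where "f = (\<lambda>i\<in>{..<n}. p ! i)"
  have count: "card {i\<in>{..<n}. f i \<le> j} = card {i. i < length p \<and> p ! i \<le> j}" for j
    using assms by (intro arg_cong[where f = card]) (auto simp: f_def)
  have "(\<forall>i<n. sort p ! i \<le> i + 1) \<longleftrightarrow> (\<forall>i<n. i + 1 \<le> card {k\<in>{..<n}. f k \<le> i + 1})"
    unfolding count using assms sort_nth_le_iff[of _ p] by (simp add: Suc_le_eq)
  also have "\<dots> \<longleftrightarrow> (\<forall>j\<le>n. j \<le> card {k\<in>{..<n}. f k \<le> j})"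
  proof (intro iffI allI impI)
    fix j assume "\<forall>i<n. i + 1 \<le> card {k\<in>{..<n}. f k \<le> i + 1}" "j \<le> n"
    then show "j \<le> card {k\<in>{..<n}. f k \<le> j}"
      by (cases j) auto
  next
    fix i assume "\<forall>j\<le>n. j \<le> card {k\<in>{..<n}. f k \<le> j}" "i < n"
    then show "i + 1 \<le> card {k\<in>{..<n}. f k \<le> i + 1}"
      by (metis Suc_eq_plus1 Suc_leI)
  qed
  finally have sort: "(\<forall>i<n. sort p ! i \<le> i + 1) \<longleftrightarrow> (\<forall>j\<le>n. j \<le> card {k\<in>{..<n}. f k \<le> j})" .
  have ge: "set p \<subseteq> {1..} \<longleftrightarrow> f \<in> {..<n} \<rightarrow>\<^sub>E {1..}"
    using assms by (auto simp: f_def PiE_iff set_conv_nth)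
  have le: "set p \<subseteq> {..n}" if "f \<in> parking_maps {..<n}"
    using parking_map_le[OF _ that] assms by (auto simp: f_def set_conv_nth)
  show ?thesis
    unfolding f_def[symmetric]
  proof
    assume "p \<in> parking_functions n"
    then have "\<forall>i<n. sort p ! i \<le> i + 1" "set p \<subseteq> {1..}"
      by (auto simp: parking_functions_def)
    then show "f \<in> parking_maps {..<n}"
      using sort ge by (simp add: parking_maps_def)
  next
    assume f: "f \<in> parking_maps {..<n}"
    then have "\<forall>i<n. sort p ! i \<le> i + 1" "set p \<subseteq> {1..}"
      using sort ge by (simp_all add: parking_maps_def)
    then show "p \<in> parking_functions n"
      using le[OF f] assms by (auto simp: parking_functions_def)
  qed
qed

lemma sum_parking_functions:
  "(\<Sum>p\<in>parking_functions n. h (area p)) = (\<Sum>f\<in>parking_maps {..<n}. h (int (map_area {..<n} f)))"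
proof (rule sum.reindex_bij_witness[where j = "\<lambda>p. \<lambda>i\<in>{..<n}. p ! i" and i = "\<lambda>f. map f [0..<n]"])
  fix p assume p: "p \<in> parking_functions n"
  then have len: "length p = n"
    by (simp add: parking_functions_def)
  show "map (\<lambda>i\<in>{..<n}. p ! i) [0..<n] = p"
    using len by (intro nth_equalityI) auto
  show f: "(\<lambda>i\<in>{..<n}. p ! i) \<in> parking_maps {..<n}"
    using parking_functions_iff[OF len] p by simp
  have "sum (\<lambda>i\<in>{..<n}. p ! i) {..<n} = sum_list p"
    using len by (simp add: sum_list_sum_nth atLeast0LessThan)
  then have "area p = int (map_area {..<n} (\<lambda>i\<in>{..<n}. p ! i))"
    using sum_parking_map_le[OF _ f] len by (simp add: area_def map_area_def of_nat_diff)
  then show "h (int (map_area {..<n} (\<lambda>i\<in>{..<n}. p ! i))) = h (area p)"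
    by simp
next
  fix f :: "nat \<Rightarrow> nat" assume f: "f \<in> parking_maps {..<n}"
  show eq: "(\<lambda>i\<in>{..<n}. map f [0..<n] ! i) = f"
    using f by (auto simp: parking_maps_def PiE_iff extensional_def fun_eq_iff)
  show "map f [0..<n] \<in> parking_functions n"
    using parking_functions_iff[of "map f [0..<n]" n] f by (simp add: eq)
qed

section \<open>Substituting the tree function into polynomials\<close>

text \<open>
  The operator \<open>z d/dz\<close>, which multiplies the coefficient of \<open>z^n\<close> by \<open>n\<close>.
\<close>

definition euler :: "'a::comm_semiring_1 fps \<Rightarrow> 'a fps" where
  "euler f = fps_X * fps_deriv f"

lemma euler_nth [simp]: "euler f $ n = of_nat n * f $ n"
  by (cases n) (simp_all add: euler_def)

lemma euler_mult: "euler (f * g) = euler f * g + f * euler g"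
  by (simp add: euler_def algebra_simps)

text \<open>
  In the application \<open>W\<close> is the exponential generating function of the number of parking functions
  and \<open>fps_X * W\<close> is the tree function \<open>T\<close>. The series substituted into \<open>p\<close> is \<open>v = z T' = T/(1 - T)\<close>.
  In this variable the generating functions of the moments are \<open>W\<close> times a polynomial. The constant term of
  \<open>v\<close> is zero, so the composition is multiplicative.
\<close>

definition tree_subst :: "real fps \<Rightarrow> real poly \<Rightarrow> real fps" where
  "tree_subst W p = W * (fps_of_poly p oo euler (fps_X * W))"

lemma tree_subst_simps:
  "tree_subst W 1 = W"
  "tree_subst W (p + q) = tree_subst W p + tree_subst W q"
  "tree_subst W (smult c p) = fps_const c * tree_subst W p"
  "tree_subst W 0 = 0"
  by (simp_all add: tree_subst_def fps_of_poly_add fps_of_poly_smult fps_compose_add_distrib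
      fps_compose_mult_distrib algebra_simps)

lemma tree_subst_sum: "tree_subst W (sum f A) = (\<Sum>x\<in>A. tree_subst W (f x))"
  by (induction A rule: infinite_finite_induct) (simp_all add: tree_subst_simps)

lemma tree_subst_nth_0: "tree_subst W p $ 0 = W $ 0 * coeff p 0"
  by (simp add: tree_subst_def)

lemma tree_subst_times: "W * tree_subst W (p * q) = tree_subst W p * tree_subst W q"
  by (simp add: tree_subst_def fps_of_poly_mult fps_compose_mult_distrib algebra_simps)

lemma tree_subst_linear:
  "tree_subst W ([:a, b:] * p) = (fps_const a + fps_const b * euler (fps_X * W)) * tree_subst W p"
proof -
  have "fps_of_poly [:a, b:] oo euler (fps_X * W) = fps_const a + fps_const b * euler (fps_X * W)"
    by (simp add: fps_of_poly_pCons fps_of_poly_const fps_compose_add_distrib fps_compose_mult_distrib)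
  then show ?thesis
    unfolding tree_subst_def fps_of_poly_mult by (simp add: fps_compose_mult_distrib mult_ac)
qed

text \<open>
  The derivation \<open>z d/dz\<close> transported to polynomials in \<open>v\<close>: it maps \<open>W\<close> to \<open>v W\<close> and \<open>v\<close> to
  \<open>v (1 + v)^2 = v + 2 v^2 + v^3\<close>.
\<close>

definition tree_deriv :: "real poly \<Rightarrow> real poly" where
  "tree_deriv p = [:0, 1:] * p + [:0, 1, 2, 1:] * pderiv p"

text \<open>
  The differential equation below is the recursion for the number of parking functions. It is the
  logarithmic derivative of the functional equation \<open>W = exp (z W)\<close> of the tree function, and everything needed
  about that function follows from it.
\<close>

context
  fixes W :: "real fps"
  assumes W: "fps_deriv W = W * fps_deriv (fps_X * W)"
begin

lemma tree_variable: "euler W = W * euler (fps_X * W)"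
  unfolding euler_def by (subst W) (simp only: mult.left_commute)

lemma one_plus_tree_variable:
  "(1 + euler (fps_X * W)) * (fps_X * W) = euler (fps_X * W)"
proof -
  have "euler (fps_X * W) = fps_X * W + fps_X * euler W"
    by (simp add: euler_mult) (simp add: euler_def)
  then show ?thesis
    by (simp add: tree_variable algebra_simps)
qed

text \<open>
  Apply \<^const>\<open>euler\<close> to \<open>(1 + v) T = v\<close>, and multiply by \<open>1 + v\<close> to eliminate \<open>T\<close>.
\<close>

lemma euler_tree_variable:
  "euler (euler (fps_X * W)) = (1 + euler (fps_X * W))\<^sup>2 * euler (fps_X * W)"
proof -
  define T v where "T = fps_X * W" and "v = euler T"
  have v: "(1 + v) * T = v"
    using one_plus_tree_variable by (simp add: v_def T_def)
  have "euler v = euler ((1 + v) * T)"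
    by (simp add: v)
  also have "\<dots> = euler v * T + (1 + v) * v"
    unfolding euler_mult v_def[symmetric] by (simp add: euler_def)
  finally have "(1 + v) * (euler v) = (1 + v) * (euler v * T + (1 + v) * v)"
    by simp
  also have "\<dots> = euler v * ((1 + v) * T) + (1 + v)\<^sup>2 * v"
    by (simp add: algebra_simps power2_eq_square)
  finally have "(1 + v) * euler v = euler v * v + (1 + v)\<^sup>2 * v"
    by (simp only: v)
  then have "euler v = (1 + v)\<^sup>2 * v"
    by (simp add: ring_distribs mult.commute)
  then show ?thesis
    by (simp add: v_def T_def)
qed

lemma euler_tree_subst: "euler (tree_subst W p) = tree_subst W (tree_deriv p)"
proof -
  define v where "v = euler (fps_X * W)"
  have v0: "v $ 0 = 0"
    by (simp add: v_def)
  have cub: "fps_of_poly [:0, 1, 2, 1:] oo v = (1 + v)\<^sup>2 * v"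
    using v0 by (simp add: fps_of_poly_pCons fps_compose_add_distrib fps_compose_mult_distrib
        algebra_simps power2_eq_square)
  have "euler (fps_of_poly p oo v) = (fps_deriv (fps_of_poly p) oo v) * euler v"
    using v0 by (simp add: euler_def fps_compose_deriv algebra_simps)
  also have "euler v = fps_of_poly [:0, 1, 2, 1:] oo v"
    using cub euler_tree_variable by (simp only: v_def)
  also have "(fps_deriv (fps_of_poly p) oo v) * (fps_of_poly [:0, 1, 2, 1:] oo v) =
      fps_of_poly ([:0, 1, 2, 1:] * pderiv p) oo v"
    by (simp only: fps_of_poly_mult fps_compose_mult_distrib[OF v0] fps_of_poly_pderiv mult.commute)
  finally have "euler (tree_subst W p) =
      euler W * (fps_of_poly p oo v) + W * (fps_of_poly ([:0, 1, 2, 1:] * pderiv p) oo v)"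
    unfolding tree_subst_def euler_mult v_def by (simp only:)
  also have "\<dots> = tree_subst W ([:0, 1:] * p) + tree_subst W ([:0, 1, 2, 1:] * pderiv p)"
    unfolding tree_subst_linear tree_variable unfolding tree_subst_def v_def by simp
  also have "\<dots> = tree_subst W (tree_deriv p)"
    by (simp only: tree_deriv_def tree_subst_simps)
  finally show ?thesis .
qed

text \<open>
  A product of two series of the form \<open>W p(v)\<close> contains \<open>W\<close> twice. One factor \<open>W\<close> is absorbed by
  \<open>(1 + v) z W = v\<close>.
\<close>

lemma tree_subst_product:
  "(1 + euler (fps_X * W)) * (fps_X * (tree_subst W p * tree_subst W q))
     = tree_subst W ([:0, 1:] * (p * q))"
proof -
  have "(1 + euler (fps_X * W)) * (fps_X * (tree_subst W p * tree_subst W q)) =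
      ((1 + euler (fps_X * W)) * (fps_X * W)) * tree_subst W (p * q)"
    unfolding tree_subst_times[symmetric] by (simp only: mult_ac)
  then show ?thesis
    unfolding one_plus_tree_variable tree_subst_linear by simp
qed

end

text \<open>
  For a generating function in \<open>z\<close>, this is the binomial coefficient of \<open>z d/dz + 1\<close> over \<open>i\<close>, as an
  operator.
\<close>

definition binom_deriv :: "nat \<Rightarrow> real fps \<Rightarrow> real fps" where
  "binom_deriv i f = Abs_fps (\<lambda>n. of_nat (Suc n choose i) * f $ n)"

fun tree_binom_deriv :: "nat \<Rightarrow> real poly \<Rightarrow> real poly" where
  "tree_binom_deriv 0 p = p"
| "tree_binom_deriv (Suc i) p =
     smult (1 / real (Suc i))
       (tree_deriv (tree_binom_deriv i p) + smult (1 - real i) (tree_binom_deriv i p))"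

text \<open>
  From \<open>(i + 1) C(n + 1, i + 1) = (n + 1 - i) C(n + 1, i)\<close>, binomial operators are polynomials in
  \<^const>\<open>euler\<close>. The identity also holds for \<open>i > n + 1\<close>, where both sides vanish.
\<close>

lemma binom_deriv_Suc:
  "binom_deriv (Suc i) f =
     fps_const (1 / real (Suc i)) * (euler (binom_deriv i f) + fps_const (1 - real i) * binom_deriv i f)"
proof (rule fps_ext)
  fix n
  have "real (Suc i) * real (Suc n choose Suc i) = (real (Suc n) - real i) * real (Suc n choose i)"
  proof (cases "i \<le> Suc n")
    case True
    then have "Suc i * (Suc n choose Suc i) = (Suc n - i) * (Suc n choose i)"
      by (metis binomial_absorb_comp binomial_absorption diff_Suc_Suc mult.commute)
    then show ?thesis
      using True by (metis of_nat_diff of_nat_mult)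
  qed (simp add: binomial_eq_0)
  then have "real (Suc n choose Suc i) = 1 / real (Suc i) * ((real n + (1 - real i)) * real (Suc n choose i))"
    by (simp add: field_simps del: binomial_Suc_Suc)
  then have "real (Suc n choose Suc i) * f $ n =
      1 / real (Suc i) * ((real n + (1 - real i)) * real (Suc n choose i)) * f $ n"
    by (rule arg_cong)
  also have "\<dots> = (fps_const (1 / real (Suc i)) *
      (euler (binom_deriv i f) + fps_const (1 - real i) * binom_deriv i f)) $ n"
    unfolding fps_mult_left_const_nth fps_add_nth euler_nth binom_deriv_def fps_nth_Abs_fps
    by (simp only: algebra_simps)
  finally show "binom_deriv (Suc i) f $ n = (fps_const (1 / real (Suc i)) *
      (euler (binom_deriv i f) + fps_const (1 - real i) * binom_deriv i f)) $ n"
    by (simp add: binom_deriv_def del: binomial_Suc_Suc)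
qed

lemma binom_deriv_tree_subst:
  assumes "fps_deriv W = W * fps_deriv (fps_X * W)"
  shows "binom_deriv i (tree_subst W p) = tree_subst W (tree_binom_deriv i p)"
proof (induction i)
  case 0
  show ?case by (rule fps_ext) (simp add: binom_deriv_def)
next
  case (Suc i)
  then show ?case
    by (simp add: binom_deriv_Suc euler_tree_subst[OF assms] tree_subst_simps)
qed

text \<open>
  The polynomials that solve the system of differential equations for the moments. Once \<open>W p(v)\<close> is
  substituted and common factors are cancelled, the \<open>j\<close>-th equation reads
  \<open>(1 + v)^2 p' - (1 + v) p = r\<close>, where \<open>r\<close> involves only the earlier polynomials. It is solved
  coefficient by coefficient. The condition that \<open>p\<close> vanishes at \<open>v = 0\<close>, as the \<open>j\<close>-th moment of the
  empty parking function does for \<open>j > 0\<close>, fixes the multiple of the homogeneous solution \<open>1 + v\<close>.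
  The value \<open>0\<close> beyond the fourth polynomial is a default.
\<close>

fun moment_poly :: "nat \<Rightarrow> real poly" where
  "moment_poly 0 = 1"
| "moment_poly (Suc 0) = [:0, 0, 1/2:]"
| "moment_poly (Suc (Suc 0)) = [:0, 0, 0, 1, 37/24, 5/8:]"
| "moment_poly (Suc (Suc (Suc 0))) = [:0, 0, 0, 1/6, 23/6, 91/8, 677/48, 395/48, 15/8:]"
| "moment_poly (Suc (Suc (Suc (Suc 0)))) =
    [:0, 0, 0, 0, 15/8, 73/3, 23087/240, 3055/16, 83777/384, 169117/1152, 20905/384, 1105/128:]"
| "moment_poly (Suc (Suc (Suc (Suc (Suc j))))) = 0"

text \<open>
  If the series \<open>F j\<close> are \<open>W\<close> times these polynomials in \<open>v\<close>, the right-hand side of the \<open>j\<close>-th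
  differential equation, multiplied by \<open>(1 + v) z\<close>, is \<open>v W\<close> times this polynomial.
\<close>

definition moment_conv :: "nat \<Rightarrow> real poly" where
  "moment_conv j =
    (\<Sum>i\<le>j. \<Sum>s\<le>j-i. tree_binom_deriv (Suc i) (moment_poly s) * moment_poly (j-i-s))"

lemma moment_poly_equation:
  assumes "j \<le> 4"
  shows "[:1, 1:] * tree_deriv (moment_poly j) = [:0, 1:] * moment_conv j"
proof -
  \<comment> \<open>Successors instead of numerals let the simplifier unfold the finite sums.\<close>
  have "j = 0 \<or> j = Suc 0 \<or> j = Suc (Suc 0) \<or> j = Suc (Suc (Suc 0)) \<or> j = Suc (Suc (Suc (Suc 0)))"
    using assms by linarith
  moreover have ?thesis if "j = 0"
    unfolding that by (simp add: moment_conv_def tree_deriv_def one_pCons)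
  moreover have ?thesis if "j = Suc 0"
    unfolding that
    by (simp add: moment_conv_def)
       (simp add: tree_deriv_def pderiv_pCons numeral_poly one_pCons)
  moreover have ?thesis if "j = Suc (Suc 0)"
    unfolding that
    by (simp add: moment_conv_def)
       (simp add: tree_deriv_def pderiv_pCons numeral_poly one_pCons)
  moreover have ?thesis if "j = Suc (Suc (Suc 0))"
    unfolding that
    by (simp add: moment_conv_def)
       (simp add: tree_deriv_def pderiv_pCons numeral_poly one_pCons)
  moreover have ?thesis if "j = Suc (Suc (Suc (Suc 0)))"
    unfolding that
    by (simp add: moment_conv_def)
       (simp add: tree_deriv_def pderiv_pCons numeral_poly one_pCons)
  ultimately show ?thesis
    by blast
qed

text \<open>
  The polynomial for the fourth moment is a combination of the iterated derivatives of those for the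
  zeroth and the first. Since \<^const>\<open>tree_deriv\<close> stands for \<open>z d/dz\<close>, which multiplies the coefficient
  of \<open>z^n\<close> by \<open>n\<close>, the coefficients here are those of the polynomials in \<open>n\<close> in the fourth factorial moment.
\<close>

lemma moment_poly_4:
  "smult 24 (moment_poly 4) =
    smult (221/1008) ((tree_deriv ^^ 6) 1) + smult (63737/30240) ((tree_deriv ^^ 5) 1)
    + smult (101897/15120) ((tree_deriv ^^ 4) 1) + smult (22217/5040) ((tree_deriv ^^ 3) 1)
    + smult (-1375/189) ((tree_deriv ^^ 2) 1) + smult (-187463/30240) (tree_deriv 1)
    + smult (-35/16) ((tree_deriv ^^ 4) (moment_poly 1)) + smult (-449/27) ((tree_deriv ^^ 3) (moment_poly 1))
    + smult (-130243/2520) ((tree_deriv ^^ 2) (moment_poly 1)) + smult (-7409/105) (tree_deriv (moment_poly 1))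
    + smult (-503803/15120) (moment_poly 1)"
  by (simp add: tree_deriv_def pderiv_pCons eval_nat_numeral one_pCons)

text \<open>
  The analogous relation for the second moment, from which the growth of the expected area is bounded.
\<close>

lemma moment_poly_2:
  "smult 2 (moment_poly 2) =
    smult (5/12) ((tree_deriv ^^ 3) 1) + smult (-1/12) ((tree_deriv ^^ 2) 1) + smult (-1/3) (tree_deriv 1)
    + smult (-7/3) (tree_deriv (moment_poly 1)) + smult (-7/3) (moment_poly 1)"
  by (simp add: tree_deriv_def pderiv_pCons eval_nat_numeral one_pCons)

section \<open>Generating functions of the area moments\<close>

text \<open>
  Up to the factor \<open>k!\<close> and the number of parking functions this is the \<open>k\<close>-th factorial moment.
  Binomial coefficients are the convenient normalization: they are the coefficients of the area
  enumerator at \<open>q = 1 + y\<close>.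
\<close>

definition area_moment :: "nat \<Rightarrow> nat \<Rightarrow> real" where
  "area_moment k n = (\<Sum>f\<in>parking_maps {..<n}. real (map_area {..<n} f choose k))"

lemma coeff_one_plus_X_power: "coeff ([:1, 1:] ^ n :: 'a::comm_semiring_1 poly) k = of_nat (n choose k)"
proof (cases "k \<le> n")
  case False
  have "degree ([:1, 1:] ^ n :: 'a poly) \<le> n"
    using degree_power_le[of "[:1, 1:] :: 'a poly" n] by simp
  then show ?thesis
    using False by (simp add: coeff_eq_0 binomial_eq_0)
qed (simp add: coeff_linear_poly_power)

lemma area_moment_eq_coeff: "area_moment k n = coeff (area_enum [:1, 1:] {..<n}) k"
  by (simp add: area_moment_def area_enum_def coeff_sum coeff_one_plus_X_power)

text \<open>
  Compare the coefficients of \<open>y^j\<close> in Kreweras' recursion at \<open>q = 1 + y\<close>. The geometric sum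
  \<open>((1 + y)^(k+1) - 1) / y\<close> contributes the shifted binomial coefficients.
\<close>

lemma area_moment_Suc:
  "area_moment j (Suc n) = (\<Sum>k\<le>n. real (n choose k) *
     (\<Sum>i\<le>j. real (Suc k choose Suc i) *
       (\<Sum>s\<le>j-i. area_moment s k * area_moment (j-i-s) (n-k))))"
proof -
  have geo: "coeff (\<Sum>x<Suc k. [:1, 1:] ^ x :: real poly) i = real (Suc k choose Suc i)" for k i
    using sum_choose_upper[of i k]
    by (simp add: coeff_sum coeff_one_plus_X_power lessThan_Suc_atMost flip: of_nat_sum del: binomial_Suc_Suc)
  show ?thesis
    unfolding area_moment_eq_coeff area_enum_Suc coeff_sum of_nat_poly mult.assoc
    by (simp only: mult_pCons_left mult_zero_left pCons_0_0 add_0_right coeff_smult coeff_mult geo)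
qed

definition area_egf :: "nat \<Rightarrow> real fps" where
  "area_egf j = Abs_fps (\<lambda>n. area_moment j n / fact n)"

text \<open>
  Kreweras' recursion for the coefficients up to \<open>y^j\<close>, read on exponential generating functions.
\<close>

definition area_ode :: "(nat \<Rightarrow> real fps) \<Rightarrow> nat \<Rightarrow> bool" where
  "area_ode F j \<longleftrightarrow>
     fps_deriv (F j) = (\<Sum>i\<le>j. \<Sum>s\<le>j-i. binom_deriv (Suc i) (F s) * F (j-i-s))"

lemma area_ode_nth:
  assumes "area_ode F j"
  shows "of_nat (Suc n) * F j $ Suc n = (\<Sum>i\<le>j. \<Sum>s\<le>j-i. \<Sum>k\<le>n.
    real (Suc k choose Suc i) * F s $ k * F (j-i-s) $ (n-k))"
proof -
  have "of_nat (Suc n) * F j $ Suc n = fps_deriv (F j) $ n"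
    by simp
  also have "\<dots> = (\<Sum>i\<le>j. \<Sum>s\<le>j-i. \<Sum>k\<le>n. real (Suc k choose Suc i) * F s $ k * F (j-i-s) $ (n-k))"
    using assms unfolding area_ode_def
    by (simp add: fps_sum_nth fps_mult_nth binom_deriv_def atLeast0AtMost del: binomial_Suc_Suc)
  finally show ?thesis .
qed

lemma area_ode_area_egf: "area_ode area_egf j"
  unfolding area_ode_def
proof (rule fps_ext)
  fix n
  have "fps_deriv (area_egf j) $ n = area_moment j (Suc n) / fact n"
    by (simp add: area_egf_def divide_simps)
  also have "\<dots> = (\<Sum>k\<le>n. \<Sum>i\<le>j. \<Sum>s\<le>j-i. real (n choose k) *
     (real (Suc k choose Suc i) * (area_moment s k * area_moment (j-i-s) (n-k))) / fact n)"
    by (simp only: area_moment_Suc sum_distrib_left sum_divide_distrib)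
  also have "\<dots> = (\<Sum>k\<le>n. \<Sum>i\<le>j. \<Sum>s\<le>j-i.
     real (Suc k choose Suc i) * area_egf s $ k * area_egf (j-i-s) $ (n-k))"
    by (intro sum.cong refl) (simp add: binomial_fact area_egf_def field_simps del: binomial_Suc_Suc)
  also have "\<dots> = (\<Sum>i\<le>j. \<Sum>k\<le>n. \<Sum>s\<le>j-i.
     real (Suc k choose Suc i) * area_egf s $ k * area_egf (j-i-s) $ (n-k))"
    by (rule sum.swap)
  also have "\<dots> = (\<Sum>i\<le>j. \<Sum>s\<le>j-i. \<Sum>k\<le>n.
     real (Suc k choose Suc i) * area_egf s $ k * area_egf (j-i-s) $ (n-k))"
    by (rule sum.cong[OF refl], rule sum.swap)
  also have "\<dots> = (\<Sum>i\<le>j. \<Sum>s\<le>j-i. binom_deriv (Suc i) (area_egf s) * area_egf (j-i-s)) $ n"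
    by (simp add: fps_sum_nth fps_mult_nth binom_deriv_def atLeast0AtMost del: binomial_Suc_Suc)
  finally show "fps_deriv (area_egf j) $ n =
      (\<Sum>i\<le>j. \<Sum>s\<le>j-i. binom_deriv (Suc i) (area_egf s) * area_egf (j-i-s)) $ n" .
qed

text \<open>
  The equations give the coefficient of \<open>z^(n+1)\<close> in \<open>F j\<close> in terms of the coefficients of order at most
  \<open>n\<close> in \<open>F 0, ..., F j\<close>.
\<close>

lemma area_ode_unique:
  assumes F: "\<And>j. j \<le> J \<Longrightarrow> area_ode F j" and G: "\<And>j. j \<le> J \<Longrightarrow> area_ode G j"
    and init: "\<And>j. j \<le> J \<Longrightarrow> F j $ 0 = G j $ 0" and j: "j \<le> J"
  shows "F j = G j"
proof (rule fps_ext)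
  fix n
  show "F j $ n = G j $ n"
    using j
  proof (induction n arbitrary: j rule: less_induct)
    case (less n)
    show ?case
    proof (cases n)
      case (Suc m)
      have IH: "F i $ k = G i $ k" if "i \<le> J" "k \<le> m" for i k
        using less.IH[of k i] that Suc by simp
      have "of_nat (Suc m) * F j $ Suc m = of_nat (Suc m) * G j $ Suc m"
        unfolding area_ode_nth[OF F[OF less.prems]] area_ode_nth[OF G[OF less.prems]]
        using less.prems by (intro sum.cong refl) (simp add: IH del: binomial_Suc_Suc)
      then show ?thesis
        unfolding Suc by (simp del: of_nat_Suc)
    qed (use init less.prems in simp)
  qed
qed

lemma area_egf_0_equation: "fps_deriv (area_egf 0) = area_egf 0 * fps_deriv (fps_X * area_egf 0)"
proof -
  have "binom_deriv (Suc 0) f = fps_deriv (fps_X * f)" for f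
    by (rule fps_ext) (simp add: binom_deriv_def algebra_simps)
  then show ?thesis
    using area_ode_area_egf[of 0] by (simp add: area_ode_def ac_simps)
qed

lemma area_egf_nth_0: "area_egf j $ 0 = (if j = 0 then 1 else 0)"
  using area_enum_empty[where 'i = nat and q = "[:1, 1:] :: real poly"]
  by (simp add: area_egf_def area_moment_eq_coeff lessThan_0 del: one_pCons)

text \<open>
  Multiplied by \<open>(1 + v) z\<close>, which may be cancelled, both sides of the differential equation become
  \<open>W\<close> times a polynomial in \<open>v\<close>, and the two polynomials agree.
\<close>

lemma area_ode_tree_subst:
  assumes "j \<le> 4"
  shows "area_ode (\<lambda>j. tree_subst (area_egf 0) (moment_poly j)) j"
proof -
  note W = area_egf_0_equation
  define W v where "W = area_egf 0" and "v = euler (fps_X * W)"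
  define R where "R = (\<Sum>i\<le>j. \<Sum>s\<le>j-i. binom_deriv (Suc i) (tree_subst W (moment_poly s)) *
     tree_subst W (moment_poly (j-i-s)))"
  have "(1 + v) * fps_X * fps_deriv (tree_subst W (moment_poly j)) =
      (1 + v) * euler (tree_subst W (moment_poly j))"
    by (simp add: euler_def mult.assoc)
  also have "\<dots> = tree_subst W ([:1, 1:] * tree_deriv (moment_poly j))"
    unfolding tree_subst_linear W_def v_def by (simp add: euler_tree_subst[OF W])
  also have "\<dots> = tree_subst W ([:0, 1:] * moment_conv j)"
    by (simp only: moment_poly_equation[OF assms])
  also have "\<dots> = (\<Sum>i\<le>j. \<Sum>s\<le>j-i. tree_subst W
      ([:0, 1:] * (tree_binom_deriv (Suc i) (moment_poly s) * moment_poly (j-i-s))))"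
    by (simp only: moment_conv_def sum_distrib_left tree_subst_sum)
  also have "\<dots> = (1 + v) * fps_X * R"
    unfolding R_def sum_distrib_left mult.assoc v_def W_def
    by (simp only: tree_subst_product[OF W] binom_deriv_tree_subst[OF W])
  finally have "(1 + v) * fps_X * fps_deriv (tree_subst W (moment_poly j)) = (1 + v) * fps_X * R" .
  \<comment> \<open>The factor \<open>1 + v\<close> is nonzero because \<open>v\<close> has no constant term.\<close>
  moreover have "(1 + v) $ 0 \<noteq> 0"
    by (simp add: v_def)
  then have "1 + v \<noteq> 0"
    by (metis fps_zero_nth)
  then have "(1 + v) * fps_X \<noteq> 0"
    by simp
  ultimately have "fps_deriv (tree_subst W (moment_poly j)) = R"
    by (simp only: mult_cancel_left) blast
  then show ?thesis
    by (simp add: area_ode_def R_def W_def)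
qed

lemma area_egf_eq_tree_subst:
  assumes "j \<le> 4"
  shows "area_egf j = tree_subst (area_egf 0) (moment_poly j)"
proof (rule area_ode_unique[OF _ area_ode_tree_subst _ assms])
  fix j :: nat assume "j \<le> 4"
  then have "j = 0 \<or> j = Suc 0 \<or> j = Suc (Suc 0) \<or> j = Suc (Suc (Suc 0)) \<or> j = Suc (Suc (Suc (Suc 0)))"
    by linarith
  then show "area_egf j $ 0 = tree_subst (area_egf 0) (moment_poly j) $ 0"
    by (auto simp: tree_subst_nth_0 area_egf_nth_0)
qed (use area_ode_area_egf in auto)

lemma tree_subst_deriv_nth:
  "tree_subst (area_egf 0) (tree_deriv p) $ n = real n * tree_subst (area_egf 0) p $ n"
  by (simp add: euler_tree_subst[OF area_egf_0_equation, symmetric])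

lemma tree_subst_deriv_power_nth:
  "tree_subst (area_egf 0) ((tree_deriv ^^ i) p) $ n = real n ^ i * tree_subst (area_egf 0) p $ n"
  by (induction i) (simp_all add: tree_subst_deriv_nth)

lemma tree_subst_moment_nth:
  assumes "j \<le> 4"
  shows "tree_subst (area_egf 0) (moment_poly j) $ n = area_moment j n / fact n"
proof -
  from area_egf_eq_tree_subst[OF assms]
  have "tree_subst (area_egf 0) (moment_poly j) $ n = area_egf j $ n"
    by simp
  then show ?thesis
    by (simp add: area_egf_def)
qed

lemma area_moment_2:
  "2 * area_moment 2 n =
    (5/12 * real n ^ 3 - 1/12 * real n ^ 2 - 1/3 * real n) * area_moment 0 n
    - 7/3 * (real n + 1) * area_moment 1 n"
proof -
  have moment_1: "tree_subst (area_egf 0) (moment_poly 1) $ n = area_moment 1 n / fact n"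
    by (rule tree_subst_moment_nth) simp
  have moment_0: "area_egf 0 $ n = area_moment 0 n / fact n"
    by (simp add: area_egf_def)
  note nth = tree_subst_deriv_nth tree_subst_deriv_power_nth tree_subst_simps(1) moment_0 moment_1
  have "2 * area_moment 2 n / fact n = tree_subst (area_egf 0) (smult 2 (moment_poly 2)) $ n"
    by (simp add: tree_subst_simps tree_subst_moment_nth)
  also have "\<dots> = ((5/12 * real n ^ 3 - 1/12 * real n ^ 2 - 1/3 * real n) * area_moment 0 n
    - 7/3 * (real n + 1) * area_moment 1 n) / fact n"
    unfolding moment_poly_2 tree_subst_simps fps_add_nth fps_mult_left_const_nth nth
    by (simp add: field_simps)
  finally show ?thesis
    by simp
qed

lemma area_moment_4:
  "24 * area_moment 4 n =
    (221/1008 * real n ^ 6 + 63737/30240 * real n ^ 5 + 101897/15120 * real n ^ 4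
        + 22217/5040 * real n ^ 3 - 1375/189 * real n ^ 2 - 187463/30240 * real n) * area_moment 0 n
    + (- (35/16) * real n ^ 4 - 449/27 * real n ^ 3 - 130243/2520 * real n ^ 2
           - 7409/105 * real n - 503803/15120) * area_moment 1 n"
    (is "_ = ?R")
proof -
  have moment_1: "tree_subst (area_egf 0) (moment_poly 1) $ n = area_moment 1 n / fact n"
    by (rule tree_subst_moment_nth) simp
  have moment_0: "area_egf 0 $ n = area_moment 0 n / fact n"
    by (simp add: area_egf_def)
  note nth = tree_subst_deriv_nth tree_subst_deriv_power_nth tree_subst_simps(1) moment_0 moment_1
  have "24 * area_moment 4 n / fact n = tree_subst (area_egf 0) (smult 24 (moment_poly 4)) $ n"
    by (simp add: tree_subst_simps tree_subst_moment_nth)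
  also have "\<dots> = ?R / fact n"
    unfolding moment_poly_4 tree_subst_simps fps_add_nth fps_mult_left_const_nth nth
    by (simp add: field_simps)
  finally show ?thesis
    by simp
qed

section \<open>Factorial moments and their growth\<close>

lemma area_moment_0_pos: "area_moment 0 n > 0"
  and card_parking_functions: "area_moment 0 n = card (parking_functions n)"
proof -
  show *: "area_moment 0 n = card (parking_functions n)"
    using sum_parking_functions[where h = "\<lambda>_. 1::real" and n = n] by (simp add: area_moment_def)
  show "area_moment 0 n > 0"
    unfolding * using finite_parking_functions[of n] parking_functions_nonempty[of n]
    by (simp add: card_gt_0_iff)
qed

lemma area_factorial_moment_eq:
  "area_factorial_moment k n = fact k * area_moment k n / area_moment 0 n"
proof -
  have "area_factorial_moment k n =
      (\<Sum>p\<in>parking_functions n. \<Prod>j<k. of_int (area p) - of_nat j) / area_moment 0 n"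
    unfolding area_factorial_moment_def random_parking_function_def card_parking_functions
    by (rule integral_pmf_of_set[OF parking_functions_nonempty finite_parking_functions])
  also have "(\<Sum>p\<in>parking_functions n. \<Prod>j<k. of_int (area p) - of_nat j) =
      (\<Sum>f\<in>parking_maps {..<n}. \<Prod>j<k. real (map_area {..<n} f) - of_nat j)"
    using sum_parking_functions[where h = "\<lambda>a. \<Prod>j<k. real_of_int a - of_nat j" and n = n] by simp
  also have "\<dots> = fact k * area_moment k n"
    unfolding area_moment_def sum_distrib_left
    by (simp add: binomial_gbinomial gbinomial_mult_fact atLeast0LessThan)
  finally show ?thesis .
qed

lemma expected_area_eq: "expected_area n = area_moment 1 n / area_moment 0 n"
  using area_factorial_moment_eq[of 1 n] by (simp add: expected_area_def area_factorial_moment_def)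

lemma expected_area_nonneg: "expected_area n \<ge> 0"
  unfolding expected_area_eq area_moment_def by (intro divide_nonneg_nonneg sum_nonneg) auto

lemma area_factorial_moment_4:
  "area_factorial_moment 4 n =
        221/1008 * real n ^ 6 + 63737/30240 * real n ^ 5 + 101897/15120 * real n ^ 4
        + 22217/5040 * real n ^ 3 - 1375/189 * real n ^ 2 - 187463/30240 * real n
        + (- (35/16) * real n ^ 4 - 449/27 * real n ^ 3 - 130243/2520 * real n ^ 2
           - 7409/105 * real n - 503803/15120) * expected_area n"
  (is "_ = ?p + ?r * _")
proof -
  have "area_factorial_moment 4 n = (?p * area_moment 0 n + ?r * area_moment 1 n) / area_moment 0 n"
    unfolding area_moment_4[symmetric] area_factorial_moment_eq by (simp add: fact_numeral)
  then show ?thesis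
    using area_moment_0_pos[of n] by (simp only: expected_area_eq add_divide_distrib) simp
qed

text \<open>
  The Cauchy-Schwarz inequality bounds the square of the expectation by the second moment. In the
  formula for the latter the expected area occurs with a negative coefficient, so that only the cubic
  polynomial in \<open>n\<close> remains. Any multiple of \<open>n^3\<close> would serve as a bound; the constant
  \<open>5/12\<close> is rounded up to \<open>1\<close>.
\<close>

lemma expected_area_power2_le: "expected_area n ^ 2 \<le> real n ^ 3"
proof -
  let ?S = "\<Sum>f\<in>parking_maps {..<n}. real (map_area {..<n} f) ^ 2"
  have pos: "area_moment 0 n > 0"
    by (rule area_moment_0_pos)
  \<comment> \<open>the square in terms of the binomial coefficients that define the moments\<close>
  have "real m ^ 2 = 2 * real (m choose 2) + real (m choose 1)" for m
    by (induction m) (simp_all add: numeral_2_eq_2 algebra_simps)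
  then have S: "?S = 2 * area_moment 2 n + area_moment 1 n"
    by (simp add: area_moment_def sum.distrib sum_distrib_left)
  have "area_moment 1 n ^ 2 \<le> ?S * area_moment 0 n"
    using sum_squared_le_sum_of_squares[of "\<lambda>f. real (map_area {..<n} f)" "parking_maps {..<n}"]
    by (simp add: area_moment_def)
  then have "expected_area n ^ 2 \<le> ?S * area_moment 0 n / area_moment 0 n ^ 2"
    unfolding expected_area_eq power_divide by (intro divide_right_mono) auto
  also have "\<dots> = ?S / area_moment 0 n"
    using pos by (simp add: power2_eq_square)
  also have "\<dots> = 5/12 * real n ^ 3 - 1/12 * real n ^ 2 - 1/3 * real n
      - (7/3 * real n + 4/3) * expected_area n"
    unfolding S area_moment_2 expected_area_eq using pos by (simp add: field_simps)
  also have "\<dots> \<le> 5/12 * real n ^ 3"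
    using expected_area_nonneg[of n] by (simp add: algebra_simps)
  also have "\<dots> \<le> real n ^ 3"
    by simp
  finally show ?thesis .
qed

lemma expected_area_bigo: "expected_area \<in> O(\<lambda>n. real n powr (3/2))"
proof (rule bigoI[where c = 1], rule always_eventually, rule allI)
  fix n
  have "expected_area n ^ 2 \<le> (real n powr (3/2)) ^ 2"
    using expected_area_power2_le[of n]
    by (cases "n = 0") (simp_all add: powr_power powr_numeral)
  then have "expected_area n \<le> real n powr (3/2)"
    by (rule power2_le_imp_le) simp
  then show "norm (expected_area n) \<le> 1 * norm (real n powr (3/2))"
    using expected_area_nonneg[of n] by simp
qed

theorem theorem2p10:
  shows "(\<forall>n::nat. n \<ge> 1 \<longrightarrow>
      area_factorial_moment 4 n =
        221/1008 * real n ^ 6 + 63737/30240 * real n ^ 5 + 101897/15120 * real n ^ 4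
        + 22217/5040 * real n ^ 3 - 1375/189 * real n ^ 2 - 187463/30240 * real n
        + (- (35/16) * real n ^ 4 - 449/27 * real n ^ 3 - 130243/2520 * real n ^ 2
           - 7409/105 * real n - 503803/15120) * expected_area n)
    \<and> (\<lambda>n::nat. area_factorial_moment 4 n - 221/1008 * real n ^ 6)
          \<in> O(\<lambda>n. real n powr (11/2))"
proof (intro conjI allI impI)
  define p r :: "nat \<Rightarrow> real" where
    "p n = 63737/30240 * real n ^ 5 + 101897/15120 * real n ^ 4
        + 22217/5040 * real n ^ 3 - 1375/189 * real n ^ 2 - 187463/30240 * real n"
    and "r n = - (35/16) * real n ^ 4 - 449/27 * real n ^ 3 - 130243/2520 * real n ^ 2
           - 7409/105 * real n - 503803/15120" for n
  have "p \<in> O(\<lambda>n. real n powr (11/2))"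
    unfolding p_def by real_asymp
  moreover have "(\<lambda>n. r n * expected_area n) \<in> O(\<lambda>n. real n powr (11/2))"
  proof -
    have powr: "real n powr 4 * real n powr (3/2) = real n powr (11/2)" for n
      by (simp only: powr_add[symmetric]) simp
    have "r \<in> O(\<lambda>n. real n powr 4)"
      unfolding r_def by real_asymp
    from landau_o.big.mult[OF this expected_area_bigo] show ?thesis
      unfolding powr .
  qed
  ultimately have "(\<lambda>n. p n + r n * expected_area n) \<in> O(\<lambda>n. real n powr (11/2))"
    by (rule sum_in_bigo)
  moreover have "area_factorial_moment 4 n - 221/1008 * real n ^ 6 = p n + r n * expected_area n" for n
    unfolding area_factorial_moment_4 p_def r_def by simp
  ultimately show "(\<lambda>n. area_factorial_moment 4 n - 221/1008 * real n ^ 6) \<in> O(\<lambda>n. real n powr (11/2))"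
    by (simp only:)
qed (rule area_factorial_moment_4)

end
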